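(* Let $G$ be a finite graph which is the union of two graphs $K$ and $H$ that have disjoint edge sets and share exactly the vertices $U=V(K)\cap V(H)=\{u_1,\ldots,u_n\}$. Let $t$ be a real number, and let $B_n(t)=\big(b_{\mathcal{A}\mathcal{B}}(t)\big)_{\mathcal{A},\mathcal{B}\in\Gamma(U)}$ be any real matrix satisfying $$T_n(t)\,B_n(t)\,T_n(t)=T_n(t).$$ Then, for all $x,y$, $$f(G;t,x,y)=\sum_{\mathcal{A},\mathcal{B}\in\Gamma(U)} b_{\mathcal{A}\mathcal{B}}(t)\, f(K/\mathcal{A};t,x,y)\, f(H/\mathcal{B};t,x,y).$$
   Context: Graphs are finite and may have loops and multiple edges. A spanning subgraph $A\subseteq G$ is a subgraph with $V(A)=V(G)$ (determined by a subset of edges); $\omega(A)$ is its number of connected components. The Negami polynomial is $$f(G;t,x,y)=\sum_{A\subseteq G,\ V(A)=V(G)} t^{\omega(A)}x^{|E(A)|}y^{|E(G)|-|E(A)|}.$$ $\Gamma(U)$ is the set of partitions of $U$, partially ordered by $\gamma\le\gamma'$ iff $\gamma'$ is a refinement of $\gamma$; for partitions $\mathcal{A},\mathcal{B}$, $\mathcal{A}\wedge\mathcal{B}$ denotes their infimum in this order (the finest partition of which both $\mathcal{A}$ and $\mathcal{B}$ are refinements), and $|\gamma|$ denotes the number of blocks of $\gamma$. $T_n(t)$ is the $|\Gamma(U)|\times|\Gamma(U)|$ matrix indexed by $\Gamma(U)$ whose $(\mathcal{A},\mathcal{B})$ entry is $t^{|\mathcal{A}\wedge\mathcal{B}|}$.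 For $\mathcal{A}=\{U_1,\ldots,U_k\}\in\Gamma(U)$, $K/\mathcal{A}$ (resp. $H/\mathcal{A}$) is the graph obtained from $K$ (resp. $H$) by identifying all vertices in each block $U_i$ into a single vertex (all edges are kept). *)

theory Defs
  imports Complex_Main "HOL-Library.Disjoint_Sets" "HOL-Library.Uprod"
begin

text \<open>Undirected multigraphs with loops: an edge \<open>e\<close> has the unordered pair \<open>ends G e\<close> of endpoints,
  and \<open>ends G e = Upair v v\<close> is a loop. The values of \<open>ends G\<close> outside \<open>edges G\<close> are irrelevant.\<close>

record ('v, 'e) mgraph =
  verts :: "'v set"
  edges :: "'e set"
  ends :: "'e \<Rightarrow> 'v uprod"

definition finite_graph :: "('v, 'e) mgraph \<Rightarrow> bool" where
  "finite_graph G \<longleftrightarrow> finite (verts G) \<and> finite (edges G) \<and>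
     (\<forall>e\<in>edges G. set_uprod (ends G e) \<subseteq> verts G)"

definition subgraph :: "('v, 'e) mgraph \<Rightarrow> ('v, 'e) mgraph \<Rightarrow> bool" where
  "subgraph K G \<longleftrightarrow> verts K \<subseteq> verts G \<and> edges K \<subseteq> edges G \<and>
     (\<forall>e\<in>edges K. ends K e = ends G e)"

definition is_union :: "('v, 'e) mgraph \<Rightarrow> ('v, 'e) mgraph \<Rightarrow> ('v, 'e) mgraph \<Rightarrow> bool" where
  "is_union G K H \<longleftrightarrow> subgraph K G \<and> subgraph H G \<and>
     verts G = verts K \<union> verts H \<and> edges G = edges K \<union> edges H"

definition adjacency :: "('v, 'e) mgraph \<Rightarrow> ('v \<times> 'v) set" where
  "adjacency G = {(u, v). \<exists>e\<in>edges G. ends G e = Upair u v}"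

definition connected_rel :: "('v, 'e) mgraph \<Rightarrow> ('v \<times> 'v) set" where
  "connected_rel G = {(u, v). u \<in> verts G \<and> v \<in> verts G \<and> (u, v) \<in> (adjacency G)\<^sup>*}"

definition num_components :: "('v, 'e) mgraph \<Rightarrow> nat" where
  "num_components G = card (verts G // connected_rel G)"

definition spanning_subgraph :: "('v, 'e) mgraph \<Rightarrow> 'e set \<Rightarrow> ('v, 'e) mgraph" where
  "spanning_subgraph G F = G\<lparr>edges := F\<rparr>"

definition negami :: "('v, 'e) mgraph \<Rightarrow> real \<Rightarrow> real \<Rightarrow> real \<Rightarrow> real" where
  "negami G t x y =
     (\<Sum>F\<in>Pow (edges G).
        t ^ num_components (spanning_subgraph G F) * x ^ card F * y ^ (card (edges G) - card F))"

definition partitions :: "'v set \<Rightarrow> 'v set set set" where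
  "partitions U = {P. partition_on U P}"

text \<open>\<open>refines U Q P\<close> says that \<open>Q\<close> is finer than \<open>P\<close>, so finer partitions are larger in this order.\<close>

definition partition_le :: "'v set \<Rightarrow> 'v set set \<Rightarrow> 'v set set \<Rightarrow> bool" where
  "partition_le U P Q \<longleftrightarrow> refines U Q P"

definition partition_inf :: "'v set \<Rightarrow> 'v set set \<Rightarrow> 'v set set \<Rightarrow> 'v set set" where
  "partition_inf U P Q =
     (THE R. R \<in> partitions U \<and> partition_le U R P \<and> partition_le U R Q \<and>
        (\<forall>S\<in>partitions U. partition_le U S P \<and> partition_le U S Q \<longrightarrow> partition_le U S R))"

definition T_matrix :: "'v set \<Rightarrow> real \<Rightarrow> 'v set set \<Rightarrow> 'v set set \<Rightarrow> real" where
  "T_matrix U t P Q = t ^ card (partition_inf U P Q)"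

definition mat_prod :: "'i set \<Rightarrow> ('i \<Rightarrow> 'i \<Rightarrow> real) \<Rightarrow> ('i \<Rightarrow> 'i \<Rightarrow> real) \<Rightarrow> 'i \<Rightarrow> 'i \<Rightarrow> real" where
  "mat_prod I M N i j = (\<Sum>k\<in>I. M i k * N k j)"

text \<open>The vertices of the quotient graph are sets of old vertices: a vertex covered by \<open>P\<close> is sent to
  its block, and any other vertex \<open>v\<close> to the singleton \<open>{v}\<close>, which is never a block of \<open>P\<close>.\<close>

definition merge :: "'v set set \<Rightarrow> 'v \<Rightarrow> 'v set" where
  "merge P v = (if v \<in> \<Union>P then (THE X. X \<in> P \<and> v \<in> X) else {v})"

definition quotient_graph :: "('v, 'e) mgraph \<Rightarrow> 'v set set \<Rightarrow> ('v set, 'e) mgraph" where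
  "quotient_graph K P =
     \<lparr>verts = merge P ` verts K, edges = edges K, ends = (\<lambda>e. map_uprod (merge P) (ends K e))\<rparr>"

end

theory Submission
  imports Defs
begin

text \<open>
  For a set \<open>A\<close> of edges of \<open>K\<close>, let \<open>\<pi>(A)\<close> be the partition of \<open>U\<close> induced by connectivity in
  \<open>A\<close>, and \<open>c(A)\<close> the number of components avoiding \<open>U\<close>; similarly for \<open>H\<close>. The components of
  \<open>A \<union> B\<close> avoiding \<open>U\<close> are those of \<open>A\<close> and those of \<open>B\<close>, and the others correspond to the blocks
  of \<open>\<pi>(A) \<and> \<pi>(B)\<close>, so \<open>\<omega>(A \<union> B) = c(A) + c(B) + |\<pi>(A) \<and> \<pi>(B)|\<close>. Forming \<open>K/P\<close> has the same effect
  on components as gluing a graph on \<open>U\<close> with components \<open>P\<close>, so \<open>\<omega>(A/P) = c(A) + |\<pi>(A) \<and> P|\<close>.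
  Collecting the subgraphs according to \<open>\<pi>\<close> gives vectors \<open>k\<close> and \<open>h\<close> with \<open>f(G) = k\<^sup>T T h\<close>,
  \<open>f(K/\<cdot>) = k\<^sup>T T\<close> and \<open>f(H/\<cdot>) = T h\<close>, and \<open>k\<^sup>T T B T h = k\<^sup>T T h\<close>.
\<close>

section \<open>Equivalence closures on a set\<close>

definition equiv_closure :: "'a set \<Rightarrow> ('a \<times> 'a) set \<Rightarrow> ('a \<times> 'a) set" where
  "equiv_closure V r = {(u, v). u \<in> V \<and> v \<in> V \<and> (u, v) \<in> r\<^sup>*}"

definition block_rel :: "'a set set \<Rightarrow> ('a \<times> 'a) set" where
  "block_rel P = {(u, v). \<exists>X\<in>P. u \<in> X \<and> v \<in> X}"

definition avoiding_classes :: "'a set \<Rightarrow> 'a set \<Rightarrow> ('a \<times> 'a) set \<Rightarrow> 'a set set" where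
  "avoiding_classes U V R = {X \<in> V // R. X \<inter> U = {}}"

lemma equiv_equiv_closure:
  assumes "sym r"
  shows "equiv V (equiv_closure V r)"
proof (rule equivI)
  show "sym (equiv_closure V r)"
    using sym_rtrancl[OF assms] by (auto simp: equiv_closure_def sym_def)
  show "trans (equiv_closure V r)"
    by (auto simp: equiv_closure_def trans_def)
qed (auto simp: equiv_closure_def refl_on_def)

text \<open>Induction along a path in \<open>r\<close>. Together with
  \<open>equiv_equiv_closure\<close> and \<open>equiv_closure_superset\<close> this makes
  \<open>equiv_closure V r\<close> the smallest equivalence on \<open>V\<close> containing a
  symmetric \<open>r \<subseteq> V \<times> V\<close>.\<close>

lemma equiv_closure_least:
  assumes "equiv V R" "r \<subseteq> R"
  shows "equiv_closure V r \<subseteq> R"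
proof (clarsimp simp: equiv_closure_def)
  fix u v assume "u \<in> V" "(u, v) \<in> r\<^sup>*"
  show "(u, v) \<in> R"
    using \<open>(u, v) \<in> r\<^sup>*\<close>
  proof induction
    case base
    show ?case using assms(1) \<open>u \<in> V\<close> by (auto elim!: equivE dest: refl_onD)
  next
    case (step w z)
    then show ?case using assms by (blast elim: equivE dest: transD)
  qed
qed

lemma equiv_closure_superset: "r \<subseteq> V \<times> V \<Longrightarrow> r \<subseteq> equiv_closure V r"
  by (auto simp: equiv_closure_def)

lemma equiv_closure_of_equiv:
  assumes "equiv V R"
  shows "equiv_closure V R = R"
  using equiv_closure_least[OF assms order_refl] equiv_closure_superset[OF equiv_type[OF assms]]
  by blast

lemma equiv_restrict:
  assumes "equiv V R" "U \<subseteq> V"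
  shows "equiv U (R \<inter> U \<times> U)"
proof (rule equivE[OF assms(1)], rule equivI)
  assume R: "refl_on V R" "sym R" "trans R"
  show "refl_on U (R \<inter> U \<times> U)" using R(1) assms(2) by (auto simp: refl_on_def)
  show "sym (R \<inter> U \<times> U)" using R(2) by (auto simp: sym_def)
  show "trans (R \<inter> U \<times> U)" using R(3) by (intro trans_Restr)
qed auto

section \<open>Partitions as equivalence relations, and their infimum\<close>

lemma equiv_block_rel: "partition_on U P \<Longrightarrow> equiv U (block_rel P)"
  unfolding block_rel_def by (rule equiv_partition_on)

lemma quotient_block_rel: "partition_on U P \<Longrightarrow> U // block_rel P = P"
  unfolding block_rel_def by (rule partition_on_eq_quotient)

text \<open>With \<open>quotient_block_rel\<close> this makes \<open>block_rel\<close> and the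
  quotient mutually inverse, so questions about partitions can be settled on relations.\<close>

lemma block_rel_quotient:
  assumes "equiv V R"
  shows "block_rel (V // R) = R"
proof (intro equalityI subrelI)
  fix u v assume "(u, v) \<in> block_rel (V // R)"
  then obtain w where w: "(w, u) \<in> R" "(w, v) \<in> R"
    by (auto simp: block_rel_def elim!: quotientE)
  show "(u, v) \<in> R"
  proof (rule equivE[OF assms])
    assume "sym R" "trans R"
    with w show "(u, v) \<in> R" by (blast dest: symD transD)
  qed
next
  fix u v assume uv: "(u, v) \<in> R"
  then have "u \<in> V" using equiv_type[OF assms] by blast
  then have "R `` {u} \<in> V // R" "u \<in> R `` {u}"
    using equiv_class_self[OF assms] by (auto intro: quotientI)
  with uv show "(u, v) \<in> block_rel (V // R)" by (auto simp: block_rel_def)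
qed

text \<open>For the converse, a block \<open>X\<close> of \<open>P\<close> is nonempty, so it has an
  element \<open>u\<close>; the block of \<open>Q\<close> around \<open>u\<close> is unique by
  disjointness and therefore takes in all of \<open>X\<close>.\<close>

lemma refines_iff_block_rel:
  assumes "partition_on U P" "partition_on U Q"
  shows "refines U P Q \<longleftrightarrow> block_rel P \<subseteq> block_rel Q"
proof
  assume ref: "refines U P Q"
  show "block_rel P \<subseteq> block_rel Q"
  proof (rule subrelI)
    fix u v assume "(u, v) \<in> block_rel P"
    then obtain X where X: "X \<in> P" "u \<in> X" "v \<in> X" by (auto simp: block_rel_def)
    then obtain Y where "Y \<in> Q" "X \<subseteq> Y" using ref by (auto simp: refines_def)
    with X show "(u, v) \<in> block_rel Q" by (auto simp: block_rel_def)
  qed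
next
  assume sub: "block_rel P \<subseteq> block_rel Q"
  have "\<exists>Y\<in>Q. X \<subseteq> Y" if X: "X \<in> P" for X
  proof -
    obtain u where u: "u \<in> X"
      using partition_onD3[OF assms(1)] X by (metis all_not_in_conv)
    then have "(u, u) \<in> block_rel Q"
      using sub X by (auto simp: block_rel_def)
    then obtain Y where Y: "Y \<in> Q" "u \<in> Y" by (auto simp: block_rel_def)
    have "X \<subseteq> Y"
    proof
      fix v assume "v \<in> X"
      then have "(u, v) \<in> block_rel P"
        using X u by (auto simp: block_rel_def)
      then obtain Y' where "Y' \<in> Q" "u \<in> Y'" "v \<in> Y'"
        using sub by (auto simp: block_rel_def)
      moreover from this have "Y' = Y"
        using Y disjointD[OF partition_onD2[OF assms(2)], of Y Y'] by blast
      ultimately show "v \<in> Y" by simp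
    qed
    with Y show ?thesis by blast
  qed
  with assms show "refines U P Q" by (auto simp: refines_def)
qed

text \<open>Finer partitions are larger in this order, so the infimum is the finest common
  coarsening. On relations, coarsening is inclusion, and the finest common coarsening becomes the
  least equivalence containing both.\<close>

lemma partition_inf_eq_quotient:
  assumes P: "partition_on U P" and Q: "partition_on U Q"
  shows "partition_inf U P Q = U // equiv_closure U (block_rel P \<union> block_rel Q)"
proof -
  let ?E = "equiv_closure U (block_rel P \<union> block_rel Q)"
  have "sym (block_rel P \<union> block_rel Q)"
    by (auto simp: block_rel_def sym_def)
  then have E: "equiv U ?E" by (rule equiv_equiv_closure)
  have part: "partition_on U (U // ?E)"
    by (rule partition_on_quotient[OF E])
  have sup: "block_rel P \<union> block_rel Q \<subseteq> ?E"
    using equiv_type[OF equiv_block_rel[OF P]] equiv_type[OF equiv_block_rel[OF Q]]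
    by (intro equiv_closure_superset) auto
  have lower: "refines U P (U // ?E)" "refines U Q (U // ?E)"
    using sup by (auto simp: refines_iff_block_rel P Q part block_rel_quotient[OF E])
  have greatest: "refines U (U // ?E) S" if "refines U P S" "refines U Q S" for S
  proof -
    have S: "partition_on U S" using that by (auto simp: refines_def)
    have "?E \<subseteq> block_rel S"
      using that by (intro equiv_closure_least equiv_block_rel S)
        (auto simp: refines_iff_block_rel P Q S)
    then show ?thesis
      by (simp add: refines_iff_block_rel part S block_rel_quotient[OF E])
  qed
  show ?thesis
    unfolding partition_inf_def partition_le_def partitions_def
  proof (rule the_equality, goal_cases)
    case 1
    show ?case using part lower greatest by simp
  next
    case (2 R)
    \<comment> \<open>Antisymmetry of refinement supplies the uniqueness that \<open>THE\<close>
      asks for.\<close>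
    show ?case
    proof (rule refines_asym)
      show "refines U R (U // ?E)" using 2 part lower by simp
      show "refines U (U // ?E) R" using 2 by (intro greatest) auto
    qed
  qed
qed

lemma partition_inf_commute: "partition_inf U P Q = partition_inf U Q P"
  unfolding partition_inf_def by (simp add: conj_ac)

section \<open>Counting the classes of a glued relation\<close>

text \<open>A class meeting \<open>U\<close> is determined by its trace on \<open>U\<close>, because
  distinct classes are disjoint, and these traces are exactly the classes of the restricted
  relation.\<close>

lemma card_quotient_split:
  assumes E: "equiv V E" and V: "finite V" and U: "U \<subseteq> V"
  shows "card (V // E) = card (avoiding_classes U V E) + card (U // (E \<inter> U \<times> U))"
proof -
  let ?M = "{X \<in> V // E. X \<inter> U \<noteq> {}}"
  have "finite (V // E)"
    using V equiv_type[OF E] by (intro finite_quotient) auto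
  moreover have "V // E = avoiding_classes U V E \<union> ?M"
    by (auto simp: avoiding_classes_def)
  moreover have "avoiding_classes U V E \<inter> ?M = {}"
    by (auto simp: avoiding_classes_def)
  ultimately have "card (V // E) = card (avoiding_classes U V E) + card ?M"
    by (metis card_Un_disjoint finite_Un)
  moreover have "bij_betw (\<lambda>X. X \<inter> U) ?M (U // (E \<inter> U \<times> U))"
  proof (rule bij_betwI')
    fix X Y assume X: "X \<in> ?M" and Y: "Y \<in> ?M"
    show "X \<inter> U = Y \<inter> U \<longleftrightarrow> X = Y"
      using quotient_disj[OF E, of X Y] X Y by blast
  next
    fix X assume X: "X \<in> ?M"
    then obtain u where u: "u \<in> X" "u \<in> U" by blast
    obtain w where w: "X = E `` {w}" "w \<in> V" using X by (auto elim: quotientE)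
    then have "X = E `` {u}" using u equiv_class_eq[OF E] by blast
    then have "X \<inter> U = (E \<inter> U \<times> U) `` {u}" using u by auto
    then show "X \<inter> U \<in> U // (E \<inter> U \<times> U)" using u by (auto intro: quotientI)
  next
    fix Y assume "Y \<in> U // (E \<inter> U \<times> U)"
    then obtain u where u: "u \<in> U" "Y = (E \<inter> U \<times> U) `` {u}" by (auto elim: quotientE)
    then have "Y = E `` {u} \<inter> U" "u \<in> E `` {u}" "E `` {u} \<in> V // E"
      using U equiv_class_self[OF E] by (auto intro: quotientI)
    then show "\<exists>X\<in>?M. Y = X \<inter> U" using u(1) by blast
  qed
  ultimately show ?thesis by (simp add: bij_betw_same_card)
qed

text \<open>A path from \<open>v\<close> cannot use a pair of \<open>s\<close>: the first such pair
  would start at a point of \<open>B\<close> already reached through \<open>r\<close>.\<close>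

lemma equiv_closure_class_avoiding:
  assumes "r \<subseteq> A \<times> A" "s \<subseteq> B \<times> B" "v \<in> A" "equiv_closure A r `` {v} \<inter> B = {}"
  shows "equiv_closure (A \<union> B) (r \<union> s) `` {v} = equiv_closure A r `` {v}"
proof
  have "(v, w) \<in> equiv_closure A r" if "(v, w) \<in> (r \<union> s)\<^sup>*" for w
    using that
  proof induction
    case base
    show ?case using assms by (auto simp: equiv_closure_def)
  next
    case (step w z)
    then have "(w, z) \<in> r" using assms by blast
    with step assms show ?case by (auto simp: equiv_closure_def)
  qed
  then show "equiv_closure (A \<union> B) (r \<union> s) `` {v} \<subseteq> equiv_closure A r `` {v}"
    by (auto simp: equiv_closure_def)
  show "equiv_closure A r `` {v} \<subseteq> equiv_closure (A \<union> B) (r \<union> s) `` {v}"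
    using rtrancl_mono[of r "r \<union> s"] by (auto simp: equiv_closure_def)
qed

text \<open>A class that misses the overlap stays on one side: a class of the
  \<open>A\<close>-closure lies in \<open>A\<close>, so missing \<open>A \<inter> B\<close> means
  missing \<open>B\<close>, and nothing from the other side can enlarge it.\<close>

lemma avoiding_classes_Un:
  assumes r: "r \<subseteq> A \<times> A" and s: "s \<subseteq> B \<times> B"
  shows "avoiding_classes (A \<inter> B) (A \<union> B) (equiv_closure (A \<union> B) (r \<union> s)) =
    avoiding_classes (A \<inter> B) A (equiv_closure A r) \<union>
    avoiding_classes (A \<inter> B) B (equiv_closure B s)"
proof -
  let ?E = "equiv_closure (A \<union> B) (r \<union> s)"
  \<comment> \<open>Passes avoidance of the overlap from a joint class down to the one-sided class
    inside it, which is the premise of \<open>clA\<close> and \<open>clB\<close>.\<close>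
  have sub: "equiv_closure C q `` {v} \<subseteq> ?E `` {v}"
    if "q \<subseteq> r \<union> s" "C \<subseteq> A \<union> B" for C q v
    using rtrancl_mono[OF that(1)] that(2) by (auto simp: equiv_closure_def)
  have clA: "?E `` {v} = equiv_closure A r `` {v}"
    if "v \<in> A" "equiv_closure A r `` {v} \<inter> (A \<inter> B) = {}" for v
    using that by (intro equiv_closure_class_avoiding r s) (auto simp: equiv_closure_def)
  have clB: "?E `` {v} = equiv_closure B s `` {v}"
    if "v \<in> B" "equiv_closure B s `` {v} \<inter> (A \<inter> B) = {}" for v
    using equiv_closure_class_avoiding[OF s r, of v] that
    by (auto simp: equiv_closure_def Un_commute)
  show ?thesis
  proof (intro equalityI subsetI)
    fix X assume "X \<in> avoiding_classes (A \<inter> B) (A \<union> B) ?E"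
    then obtain v where v: "v \<in> A \<union> B" "X = ?E `` {v}" "X \<inter> (A \<inter> B) = {}"
      by (auto simp: avoiding_classes_def elim: quotientE)
    from v(1) show "X \<in> avoiding_classes (A \<inter> B) A (equiv_closure A r) \<union>
        avoiding_classes (A \<inter> B) B (equiv_closure B s)"
    proof
      assume "v \<in> A"
      moreover have "X = equiv_closure A r `` {v}"
        using clA[OF \<open>v \<in> A\<close>] sub[of r A v] v by blast
      ultimately show ?thesis using v by (auto simp: avoiding_classes_def intro: quotientI)
    next
      assume "v \<in> B"
      moreover have "X = equiv_closure B s `` {v}"
        using clB[OF \<open>v \<in> B\<close>] sub[of s B v] v by blast
      ultimately show ?thesis using v by (auto simp: avoiding_classes_def intro: quotientI)
    qed
  next
    fix X assume "X \<in> avoiding_classes (A \<inter> B) A (equiv_closure A r) \<union>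
        avoiding_classes (A \<inter> B) B (equiv_closure B s)"
    then show "X \<in> avoiding_classes (A \<inter> B) (A \<union> B) ?E"
    proof
      assume "X \<in> avoiding_classes (A \<inter> B) A (equiv_closure A r)"
      then obtain v where v: "v \<in> A" "X = equiv_closure A r `` {v}" and X: "X \<inter> (A \<inter> B) = {}"
        by (auto simp: avoiding_classes_def elim: quotientE)
      then have "X = ?E `` {v}" using clA by simp
      with v(1) X show ?thesis by (simp add: avoiding_classes_def quotientI)
    next
      assume "X \<in> avoiding_classes (A \<inter> B) B (equiv_closure B s)"
      then obtain v where v: "v \<in> B" "X = equiv_closure B s `` {v}" and X: "X \<inter> (A \<inter> B) = {}"
        by (auto simp: avoiding_classes_def elim: quotientE)
      then have "X = ?E `` {v}" using clB by simp
      with v(1) X show ?thesis by (simp add: avoiding_classes_def quotientI)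
    qed
  qed
qed

text \<open>A path between vertices of \<open>A \<inter> B\<close> is cut at its visits to \<open>A \<inter> B\<close>; each piece stays on one
  side.\<close>

lemma equiv_closure_Un_restrict:
  assumes r: "r \<subseteq> A \<times> A" and s: "s \<subseteq> B \<times> B"
  defines "R \<equiv> equiv_closure A r" and "S \<equiv> equiv_closure B s" and "U \<equiv> A \<inter> B"
  shows "equiv_closure (A \<union> B) (r \<union> s) \<inter> U \<times> U =
    equiv_closure U (R \<inter> U \<times> U \<union> S \<inter> U \<times> U)"
proof -
  let ?Q = "R \<inter> U \<times> U \<union> S \<inter> U \<times> U"
  \<comment> \<open>Path invariant: \<open>u'\<close> is a point of \<open>U\<close> on the path,
    already reached through \<open>?Q\<close>, and everything after it lies on a single
    side.\<close>
  have last_visit: "\<exists>u'\<in>U. (u, u') \<in> ?Q\<^sup>* \<and> (u', w) \<in> R \<union> S"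
    if "u \<in> U" "(u, w) \<in> (r \<union> s)\<^sup>*" for u w
    using that(2)
  proof induction
    case base
    then show ?case using that(1) by (auto simp: U_def R_def equiv_closure_def)
  next
    case (step w z)
    then obtain u' where u': "u' \<in> U" "(u, u') \<in> ?Q\<^sup>*" "(u', w) \<in> R \<union> S" by blast
    have RS: "R \<subseteq> A \<times> A" "S \<subseteq> B \<times> B" by (auto simp: R_def S_def equiv_closure_def)
    have ext: "(w', w) \<in> R \<Longrightarrow> (w, z) \<in> r \<Longrightarrow> (w', z) \<in> R"
        "(w', w) \<in> S \<Longrightarrow> (w, z) \<in> s \<Longrightarrow> (w', z) \<in> S" for w'
      using r s by (auto simp: R_def S_def equiv_closure_def)
    have self: "w \<in> A \<Longrightarrow> (w, w) \<in> R" "w \<in> B \<Longrightarrow> (w, w) \<in> S"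
      by (auto simp: R_def S_def equiv_closure_def)
    show ?case
    proof (cases "w \<in> U")
      case True
      then have "(u', w) \<in> ?Q" using u' by auto
      then have "(u, w) \<in> ?Q\<^sup>*" using u' by (meson rtrancl.rtrancl_into_rtrancl)
      moreover have "(w, z) \<in> R \<union> S"
        using step(2) True ext[of w] self by (auto simp: U_def)
      ultimately show ?thesis using True by blast
    next
      \<comment> \<open>Outside \<open>U\<close> the point \<open>w\<close> belongs to only one of
        \<open>A\<close> and \<open>B\<close>, so the pair leaving \<open>w\<close> comes from the
        same side as the piece arriving there.\<close>
      case False
      then have "(u', z) \<in> R \<union> S"
        using step(2) u'(3) ext[of u'] RS r s by (auto simp: U_def)
      then show ?thesis using u' by blast
    qed
  qed
  show ?thesis
  proof (intro equalityI subrelI)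
    fix u v assume "(u, v) \<in> equiv_closure (A \<union> B) (r \<union> s) \<inter> U \<times> U"
    then have uv: "u \<in> U" "v \<in> U" "(u, v) \<in> (r \<union> s)\<^sup>*" by (auto simp: equiv_closure_def)
    then obtain u' where "u' \<in> U" "(u, u') \<in> ?Q\<^sup>*" "(u', v) \<in> ?Q"
      using last_visit[of u v] by blast
    then have "(u, v) \<in> ?Q\<^sup>*" by (meson rtrancl.rtrancl_into_rtrancl)
    then show "(u, v) \<in> equiv_closure U ?Q" using uv by (simp add: equiv_closure_def)
  next
    fix u v assume uv: "(u, v) \<in> equiv_closure U ?Q"
    have "?Q \<subseteq> (r \<union> s)\<^sup>*"
      using rtrancl_mono[of r "r \<union> s"] rtrancl_mono[of s "r \<union> s"]
      by (auto simp: R_def S_def equiv_closure_def)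
    from rtrancl_subset_rtrancl[OF this]
    show "(u, v) \<in> equiv_closure (A \<union> B) (r \<union> s) \<inter> U \<times> U"
      using uv by (auto simp: equiv_closure_def U_def)
  qed
qed

text \<open>Stated for relations rather than graphs in order to serve twice: \<open>s\<close> is the
  adjacency of a second graph for unions, and the block relation of a partition for quotient
  graphs.\<close>

lemma card_quotient_equiv_closure_Un:
  assumes r: "r \<subseteq> A \<times> A" "sym r" and s: "s \<subseteq> B \<times> B" "sym s" and fin: "finite A" "finite B"
  defines "R \<equiv> equiv_closure A r" and "S \<equiv> equiv_closure B s" and "U \<equiv> A \<inter> B"
  shows "card ((A \<union> B) // equiv_closure (A \<union> B) (r \<union> s)) =
    card (avoiding_classes U A R) + card (avoiding_classes U B S) +
    card (partition_inf U (U // (R \<inter> U \<times> U)) (U // (S \<inter> U \<times> U)))"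
proof -
  let ?E = "equiv_closure (A \<union> B) (r \<union> s)"
  have E: "equiv (A \<union> B) ?E"
    using r s by (intro equiv_equiv_closure) (auto simp: sym_def)
  have R: "equiv A R" and S: "equiv B S"
    unfolding R_def S_def using r s by (auto intro: equiv_equiv_closure)
  have RU: "equiv U (R \<inter> U \<times> U)" and SU: "equiv U (S \<inter> U \<times> U)"
    using equiv_restrict[OF R, of U] equiv_restrict[OF S, of U] by (auto simp: U_def)
  \<comment> \<open>A common member would be a nonempty subset of \<open>A \<inter> B\<close>, which
    is \<open>U\<close>, and yet miss \<open>U\<close>.\<close>
  have "avoiding_classes U A R \<inter> avoiding_classes U B S = {}"
  proof -
    have "X \<noteq> {}" "X \<subseteq> A" if "X \<in> avoiding_classes U A R" for X
      using that partition_onD1[OF partition_on_quotient[OF R]]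
        partition_onD3[OF partition_on_quotient[OF R]]
      by (auto simp: avoiding_classes_def)
    moreover have "X \<subseteq> B" if "X \<in> avoiding_classes U B S" for X
      using that partition_onD1[OF partition_on_quotient[OF S]]
      by (auto simp: avoiding_classes_def)
    ultimately show ?thesis
      by (fastforce simp: avoiding_classes_def U_def)
  qed
  moreover have "finite (avoiding_classes U A R)" "finite (avoiding_classes U B S)"
    using finite_quotient[OF _ equiv_type[OF R]] finite_quotient[OF _ equiv_type[OF S]] fin
    by (auto simp: avoiding_classes_def)
  ultimately have "card (avoiding_classes U (A \<union> B) ?E) =
      card (avoiding_classes U A R) + card (avoiding_classes U B S)"
    unfolding U_def R_def S_def avoiding_classes_Un[OF r(1) s(1)]
    by (intro card_Un_disjoint)
  moreover have "card ((A \<union> B) // ?E) =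
      card (avoiding_classes U (A \<union> B) ?E) + card (U // (?E \<inter> U \<times> U))"
    using fin by (intro card_quotient_split E) (auto simp: U_def)
  moreover have "U // (?E \<inter> U \<times> U) =
      partition_inf U (U // (R \<inter> U \<times> U)) (U // (S \<inter> U \<times> U))"
    using equiv_closure_Un_restrict[OF r(1) s(1)]
    unfolding partition_inf_eq_quotient[OF partition_on_quotient[OF RU] partition_on_quotient[OF SU]]
      block_rel_quotient[OF RU] block_rel_quotient[OF SU]
    by (simp add: U_def R_def S_def)
  ultimately show ?thesis by simp
qed

section \<open>Components of a union of graphs\<close>

text \<open>This and \<open>induced_partition\<close> are the quantities \<open>c\<close> and
  \<open>\<pi>\<close> of the opening overview.\<close>

definition avoiding_components :: "'v set \<Rightarrow> ('v, 'e) mgraph \<Rightarrow> nat" where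
  "avoiding_components U G = card (avoiding_classes U (verts G) (connected_rel G))"

definition induced_partition :: "'v set \<Rightarrow> ('v, 'e) mgraph \<Rightarrow> 'v set set" where
  "induced_partition U G = U // (connected_rel G \<inter> U \<times> U)"

lemma connected_rel_eq_equiv_closure: "connected_rel G = equiv_closure (verts G) (adjacency G)"
  by (simp add: connected_rel_def equiv_closure_def)

lemma sym_adjacency: "sym (adjacency G)"
proof (rule symI)
  fix u v assume "(u, v) \<in> adjacency G"
  then obtain e where "e \<in> edges G" "ends G e = Upair v u" by (auto simp: adjacency_def)
  then show "(v, u) \<in> adjacency G" by (auto simp: adjacency_def)
qed

lemma adjacency_subset:
  assumes "finite_graph G"
  shows "adjacency G \<subseteq> verts G \<times> verts G"
proof (rule subrelI)
  fix u v assume "(u, v) \<in> adjacency G"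
  then obtain e where e: "e \<in> edges G" "ends G e = Upair u v" by (auto simp: adjacency_def)
  have "set_uprod (ends G e) \<subseteq> verts G"
    using e(1) assms unfolding finite_graph_def by blast
  then show "(u, v) \<in> verts G \<times> verts G" by (simp add: e(2))
qed

lemma equiv_connected_rel: "equiv (verts G) (connected_rel G)"
  unfolding connected_rel_eq_equiv_closure by (intro equiv_equiv_closure sym_adjacency)

lemma induced_partition_in_partitions:
  "U \<subseteq> verts G \<Longrightarrow> induced_partition U G \<in> partitions U"
  unfolding partitions_def induced_partition_def
  by (simp add: partition_on_quotient equiv_restrict[OF equiv_connected_rel])

lemma adjacency_union: "is_union G K H \<Longrightarrow> adjacency G = adjacency K \<union> adjacency H"
  by (auto simp: adjacency_def is_union_def subgraph_def)

lemma num_components_union: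
  assumes "finite_graph K" "finite_graph H" "is_union G K H" and U: "U = verts K \<inter> verts H"
  shows "num_components G = avoiding_components U K + avoiding_components U H +
    card (partition_inf U (induced_partition U K) (induced_partition U H))"
proof -
  have "verts G = verts K \<union> verts H" using assms by (simp add: is_union_def)
  then show ?thesis
    using card_quotient_equiv_closure_Un[OF adjacency_subset[OF assms(1)] sym_adjacency
        adjacency_subset[OF assms(2)] sym_adjacency] assms
    by (simp add: num_components_def avoiding_components_def induced_partition_def
        connected_rel_eq_equiv_closure adjacency_union finite_graph_def)
qed

section \<open>Components of a quotient graph\<close>

lemma card_quotient_vimage:
  assumes Q: "equiv (f ` V) Q"
  shows "card ((f ` V) // Q) = card (V // {(u, v). u \<in> V \<and> v \<in> V \<and> (f u, f v) \<in> Q})"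
proof -
  let ?R = "{(u, v). u \<in> V \<and> v \<in> V \<and> (f u, f v) \<in> Q}"
  have cl: "f -` (Q `` {f u}) \<inter> V = ?R `` {u}" if "u \<in> V" for u
    using that by auto
  have "bij_betw (\<lambda>X. f -` X \<inter> V) ((f ` V) // Q) (V // ?R)"
  proof (rule bij_betwI')
    fix X Y assume "X \<in> f ` V // Q" "Y \<in> f ` V // Q"
    then have "X \<subseteq> f ` V" "Y \<subseteq> f ` V" using Union_quotient[OF Q] by blast+
    then have "f ` (f -` X \<inter> V) = X" "f ` (f -` Y \<inter> V) = Y" by auto
    then show "f -` X \<inter> V = f -` Y \<inter> V \<longleftrightarrow> X = Y" by metis
  next
    fix X assume "X \<in> f ` V // Q"
    then obtain u where u: "u \<in> V" "X = Q `` {f u}" by (auto elim: quotientE)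
    show "f -` X \<inter> V \<in> V // ?R"
      unfolding u(2) cl[OF u(1)] by (rule quotientI[OF u(1)])
  next
    fix Y assume "Y \<in> V // ?R"
    then obtain u where u: "u \<in> V" "Y = ?R `` {u}" by (rule quotientE)
    then show "\<exists>X\<in>f ` V // Q. Y = f -` X \<inter> V"
      by (intro bexI[of _ "Q `` {f u}"] quotientI imageI) (simp_all only: cl)
  qed
  then show ?thesis by (rule bij_betw_same_card)
qed

text \<open>The disjunct \<open>u = v\<close> accounts for vertices outside \<open>U\<close>: their
  singletons are never blocks, so they are identified with nothing else.\<close>

lemma merge_eq_iff:
  assumes "partition_on U P"
  shows "merge P u = merge P v \<longleftrightarrow> u = v \<or> (u, v) \<in> block_rel P"
proof -
  have the: "(THE X. X \<in> P \<and> w \<in> X) = X" if "X \<in> P" "w \<in> X" for X w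
    using that partition_onD2[OF assms] by (intro the_equality) (auto dest: disjointD)
  have in_block: "\<exists>X\<in>P. w \<in> X \<and> merge P w = X" if "w \<in> \<Union>P" for w
    using that the by (auto simp: merge_def)
  have singleton: "merge P w = {w}" if "w \<notin> \<Union>P" for w
    using that by (simp add: merge_def)
  show ?thesis
  proof
    assume "merge P u = merge P v"
    then show "u = v \<or> (u, v) \<in> block_rel P"
      using in_block[of u] in_block[of v] singleton[of u] singleton[of v]
      unfolding block_rel_def by (cases "u \<in> \<Union>P"; cases "v \<in> \<Union>P") auto
  next
    assume "u = v \<or> (u, v) \<in> block_rel P"
    then show "merge P u = merge P v"
      using the by (auto simp: block_rel_def merge_def)
  qed
qed

lemma adjacency_quotient_graph:
  "adjacency (quotient_graph K P) = map_prod (merge P) (merge P) ` adjacency K"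
proof (intro equalityI subrelI)
  fix p q assume "(p, q) \<in> adjacency (quotient_graph K P)"
  then obtain e where e: "e \<in> edges K" "map_uprod (merge P) (ends K e) = Upair p q"
    by (auto simp: adjacency_def quotient_graph_def)
  obtain a b where ab: "ends K e = Upair a b" by (cases "ends K e")
  \<comment> \<open>Equality of unordered pairs matches \<open>p\<close>, \<open>q\<close> with
    \<open>a\<close>, \<open>b\<close> in either order, so both orientations are needed.\<close>
  have "(a, b) \<in> adjacency K" "(b, a) \<in> adjacency K"
    using e ab sym_adjacency[of K] by (auto simp: adjacency_def dest: symD)
  then show "(p, q) \<in> map_prod (merge P) (merge P) ` adjacency K"
    using e ab by force
next
  fix p q assume "(p, q) \<in> map_prod (merge P) (merge P) ` adjacency K"
  then show "(p, q) \<in> adjacency (quotient_graph K P)"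
    by (force simp: adjacency_def quotient_graph_def)
qed

text \<open>Identifying the vertices of a block has the same effect on connectivity as joining them.
  A step of \<open>adjacency K\<close> maps to a step of the quotient, a step of
  \<open>block_rel P\<close> to equality; conversely, a quotient path lifts, with block steps
  inserted wherever consecutive lifted edges do not meet.\<close>

lemma connected_rel_quotient_graph:
  assumes P: "partition_on U P" and U: "U \<subseteq> verts K" and K: "finite_graph K"
  shows "{(u, v). u \<in> verts K \<and> v \<in> verts K \<and>
      (merge P u, merge P v) \<in> connected_rel (quotient_graph K P)} =
    equiv_closure (verts K) (adjacency K \<union> block_rel P)"
proof -
  let ?a = "adjacency (quotient_graph K P)" and ?r = "adjacency K \<union> block_rel P"
  have down: "(merge P u, merge P v) \<in> ?a\<^sup>*" if "(u, v) \<in> ?r\<^sup>*" for u v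
    using that
  proof induction
    case (step w z)
    from step(2) have "(merge P w, merge P z) \<in> ?a\<^sup>*"
    proof
      assume "(w, z) \<in> adjacency K"
      then show ?thesis unfolding adjacency_quotient_graph by force
    next
      assume "(w, z) \<in> block_rel P"
      then have "merge P w = merge P z" by (simp add: merge_eq_iff[OF P])
      then show ?thesis by simp
    qed
    with step(3) show ?case by simp
  qed simp
  have fibre: "(u, v) \<in> ?r\<^sup>*" if "merge P u = merge P v" for u v
    using that by (auto simp: merge_eq_iff[OF P])
  \<comment> \<open>The induction quantifies over all preimages \<open>v\<close> of the endpoint,
    since the next edge may leave from a different one; \<open>fibre\<close> connects them.\<close>
  have up: "\<forall>v. q = merge P v \<longrightarrow> (u, v) \<in> ?r\<^sup>*" if "(merge P u, q) \<in> ?a\<^sup>*" for u q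
    using that
  proof induction
    case base
    then show ?case using fibre by blast
  next
    case (step p q)
    then obtain w z where wz: "p = merge P w" "q = merge P z" "(w, z) \<in> adjacency K"
      unfolding adjacency_quotient_graph by auto
    then have "(u, w) \<in> ?r\<^sup>*" "(w, z) \<in> ?r" using step(3) by blast+
    then have "(u, z) \<in> ?r\<^sup>*" by (rule rtrancl.rtrancl_into_rtrancl)
    with wz show ?case using fibre by (meson rtrancl_trans)
  qed
  show ?thesis
    using down up
    by (auto simp: connected_rel_def equiv_closure_def quotient_graph_def)
qed

text \<open>The gluing count with second vertex set \<open>U\<close> and relation
  \<open>block_rel P\<close>: the overlap is \<open>U\<close>, the union is \<open>verts K\<close>,
  and the partition induced on \<open>U\<close> by the second side is \<open>P\<close>
  itself.\<close>

lemma num_components_quotient_graph: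
  assumes P: "partition_on U P" and U: "U \<subseteq> verts K" and K: "finite_graph K"
  shows "num_components (quotient_graph K P) =
    avoiding_components U K + card (partition_inf U (induced_partition U K) P)"
proof -
  have B: "equiv U (block_rel P)" by (rule equiv_block_rel[OF P])
  have int: "verts K \<inter> U = U" and un: "verts K \<union> U = verts K" using U by auto
  have vq: "verts (quotient_graph K P) = merge P ` verts K"
    by (simp add: quotient_graph_def)
  have fin: "finite (verts K)" "finite U"
    using K U by (auto simp: finite_graph_def intro: finite_subset)
  have sym: "sym (block_rel P)" using B by (auto elim: equivE)
  \<comment> \<open>Blocks are nonempty subsets of \<open>U\<close>, so the second side adds no
    avoiding class.\<close>
  have "avoiding_classes U U (block_rel P) = {}"
    unfolding avoiding_classes_def quotient_block_rel[OF P]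
    using partition_onD1[OF P] partition_onD3[OF P]
    by (auto simp: Int_absorb2 Union_upper)
  moreover have "num_components (quotient_graph K P) =
      card (verts K // equiv_closure (verts K) (adjacency K \<union> block_rel P))"
    unfolding num_components_def vq connected_rel_quotient_graph[OF P U K, symmetric]
    using equiv_connected_rel[of "quotient_graph K P"]
    by (intro card_quotient_vimage) (simp add: vq)
  moreover have "block_rel P \<inter> U \<times> U = block_rel P"
    using equiv_type[OF B] by blast
  ultimately show ?thesis
    using card_quotient_equiv_closure_Un[OF adjacency_subset[OF K] sym_adjacency
        equiv_type[OF B] sym fin]
    unfolding int un equiv_closure_of_equiv[OF B]
    by (simp add: avoiding_components_def induced_partition_def
        connected_rel_eq_equiv_closure quotient_block_rel[OF P])
qed

section \<open>Expanding the Negami polynomials\<close>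

text \<open>The part of a Negami term that depends on one side only. The entries of \<open>k\<close>
  and \<open>h\<close> in the overview are sums of these weights over the \<open>F\<close> with a
  given induced partition; here the sums stay indexed by \<open>F\<close>.\<close>

definition subgraph_weight ::
    "'v set \<Rightarrow> ('v, 'e) mgraph \<Rightarrow> real \<Rightarrow> real \<Rightarrow> real \<Rightarrow> 'e set \<Rightarrow> real" where
  "subgraph_weight U K t x y F = t ^ avoiding_components U (spanning_subgraph K F) *
     x ^ card F * y ^ (card (edges K) - card F)"

lemma finite_graph_spanning_subgraph:
  "finite_graph K \<Longrightarrow> F \<subseteq> edges K \<Longrightarrow> finite_graph (spanning_subgraph K F)"
  by (auto simp: finite_graph_def spanning_subgraph_def intro: finite_subset)

text \<open>Identifying vertices keeps the edge set and commutes with passing to a spanning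
  subgraph, so each term is evaluated by \<open>num_components_quotient_graph\<close>.\<close>

lemma negami_quotient_graph:
  assumes K: "finite_graph K" and U: "U \<subseteq> verts K" and P: "P \<in> partitions U"
  shows "negami (quotient_graph K P) t x y =
    (\<Sum>F\<in>Pow (edges K). subgraph_weight U K t x y F *
       T_matrix U t (induced_partition U (spanning_subgraph K F)) P)"
proof -
  have nc: "num_components (spanning_subgraph (quotient_graph K P) F) =
      avoiding_components U (spanning_subgraph K F) +
      card (partition_inf U (induced_partition U (spanning_subgraph K F)) P)"
    if "F \<subseteq> edges K" for F
  proof -
    have "spanning_subgraph (quotient_graph K P) F = quotient_graph (spanning_subgraph K F) P"
      by (simp add: spanning_subgraph_def quotient_graph_def)
    moreover have "U \<subseteq> verts (spanning_subgraph K F)"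
      using U by (simp add: spanning_subgraph_def)
    ultimately show ?thesis
      using num_components_quotient_graph[OF _ _ finite_graph_spanning_subgraph[OF K that]] P
      by (simp add: partitions_def)
  qed
  have "edges (quotient_graph K P) = edges K" by (simp add: quotient_graph_def)
  then show ?thesis
    by (simp add: negami_def nc subgraph_weight_def T_matrix_def power_add mult_ac)
qed

lemma sum_Pow_Un_disjoint:
  assumes "A \<inter> B = {}"
  shows "(\<Sum>F\<in>Pow (A \<union> B). g F) = (\<Sum>X\<in>Pow A. \<Sum>Y\<in>Pow B. g (X \<union> Y))"
proof -
  have "(\<Sum>X\<in>Pow A. \<Sum>Y\<in>Pow B. g (X \<union> Y)) = (\<Sum>(X, Y)\<in>Pow A \<times> Pow B. g (X \<union> Y))"
    by (rule sum.cartesian_product)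
  also have "\<dots> = (\<Sum>F\<in>Pow (A \<union> B). g F)"
    by (rule sum.reindex_bij_witness[of _ "\<lambda>F. (F \<inter> A, F \<inter> B)" "\<lambda>(X, Y). X \<union> Y"])
      (use assms in auto)
  finally show ?thesis by simp
qed

text \<open>An edge subset of \<open>G\<close> splits uniquely into its parts in \<open>K\<close>
  and \<open>H\<close>. All exponents are then additive, and only the infimum of the induced
  partitions couples the two sides.\<close>

lemma negami_union:
  assumes K: "finite_graph K" and H: "finite_graph H" and G: "is_union G K H"
    and disj: "edges K \<inter> edges H = {}" and U: "U = verts K \<inter> verts H"
  shows "negami G t x y = (\<Sum>A\<in>Pow (edges K). \<Sum>B\<in>Pow (edges H).
    subgraph_weight U K t x y A * subgraph_weight U H t x y B *
    T_matrix U t (induced_partition U (spanning_subgraph K A))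
      (induced_partition U (spanning_subgraph H B)))"
proof -
  have eG: "edges G = edges K \<union> edges H" using G by (simp add: is_union_def)
  have fin: "finite (edges K)" "finite (edges H)" using K H by (auto simp: finite_graph_def)
  show ?thesis
    unfolding negami_def eG sum_Pow_Un_disjoint[OF disj]
  proof (intro sum.cong refl)
    fix A B assume "A \<in> Pow (edges K)" "B \<in> Pow (edges H)"
    then have A: "A \<subseteq> edges K" and B: "B \<subseteq> edges H" by auto
    have "is_union (spanning_subgraph G (A \<union> B)) (spanning_subgraph K A) (spanning_subgraph H B)"
      using G A B by (auto simp: is_union_def subgraph_def spanning_subgraph_def)
    moreover have "U = verts (spanning_subgraph K A) \<inter> verts (spanning_subgraph H B)"
      using U by (simp add: spanning_subgraph_def)
    ultimately have nc: "num_components (spanning_subgraph G (A \<union> B)) =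
        avoiding_components U (spanning_subgraph K A) +
        avoiding_components U (spanning_subgraph H B) +
        card (partition_inf U (induced_partition U (spanning_subgraph K A))
          (induced_partition U (spanning_subgraph H B)))"
      by (intro num_components_union finite_graph_spanning_subgraph K H A B)
    have cAB: "card (A \<union> B) = card A + card B"
      using A B fin disj by (intro card_Un_disjoint) (auto intro: finite_subset)
    have "card (edges K \<union> edges H) = card (edges K) + card (edges H)"
      using fin disj by (intro card_Un_disjoint)
    moreover have "card A \<le> card (edges K)" "card B \<le> card (edges H)"
      using A B fin by (auto intro: card_mono)
    \<comment> \<open>Subtraction is truncated on naturals; the two cardinality bounds make it
      split.\<close>
    ultimately have diff: "card (edges K \<union> edges H) - (card A + card B) =
        (card (edges K) - card A) + (card (edges H) - card B)"
      by simp
    show "t ^ num_components (spanning_subgraph G (A \<union> B)) * x ^ card (A \<union> B) *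
        y ^ (card (edges K \<union> edges H) - card (A \<union> B)) =
      subgraph_weight U K t x y A * subgraph_weight U H t x y B *
      T_matrix U t (induced_partition U (spanning_subgraph K A))
        (induced_partition U (spanning_subgraph H B))"
      unfolding nc cAB diff by (simp add: subgraph_weight_def T_matrix_def power_add)
  qed
qed

section \<open>The splitting formula\<close>

theorem theorem1:
  fixes G K H :: "('v, 'e) mgraph"
    and U :: "'v set"
    and t x y :: real
    and b :: "'v set set \<Rightarrow> 'v set set \<Rightarrow> real"
  assumes "finite_graph G" and "finite_graph K" and "finite_graph H"
    and "is_union G K H"
    and "edges K \<inter> edges H = {}"
    and "U = verts K \<inter> verts H"
    and "\<And>P Q. P \<in> partitions U \<Longrightarrow> Q \<in> partitions U \<Longrightarrow>
           mat_prod (partitions U) (mat_prod (partitions U) (T_matrix U t) b) (T_matrix U t) P Q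
             = T_matrix U t P Q"
  shows "negami G t x y =
    (\<Sum>P\<in>partitions U. \<Sum>Q\<in>partitions U.
       b P Q * negami (quotient_graph K P) t x y * negami (quotient_graph H Q) t x y)"
proof -
  let ?I = "partitions U" and ?T = "T_matrix U t"
  let ?k = "subgraph_weight U K t x y" and ?h = "subgraph_weight U H t x y"
  let ?p = "\<lambda>A. induced_partition U (spanning_subgraph K A)"
  let ?q = "\<lambda>B. induced_partition U (spanning_subgraph H B)"
  have UK: "U \<subseteq> verts K" and UH: "U \<subseteq> verts H" using assms(6) by auto
  have p: "?p A \<in> ?I" and q: "?q B \<in> ?I" for A B
    using UK UH by (auto intro!: induced_partition_in_partitions simp: spanning_subgraph_def)
  \<comment> \<open>\<open>expand\<close> yields \<open>?T S (?q B)\<close>, while the expansion of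
    the quotient of \<open>H\<close> has the arguments reversed.\<close>
  have T: "?T P Q = ?T Q P" for P Q
    by (simp add: T_matrix_def partition_inf_commute)
  \<comment> \<open>The hypothesis on \<open>b\<close>, read from right to left entry by entry; the
    swap is due to the left-nested product, whose outer sum runs over the second index of
    \<open>b\<close>.\<close>
  have expand: "?T P Q = (\<Sum>R\<in>?I. \<Sum>S\<in>?I. ?T P R * b R S * ?T S Q)"
    if "P \<in> ?I" "Q \<in> ?I" for P Q
    unfolding assms(7)[OF that, symmetric] mat_prod_def sum_distrib_right
    by (rule sum.swap)
  have "negami G t x y =
      (\<Sum>A\<in>Pow (edges K). \<Sum>B\<in>Pow (edges H). ?k A * ?h B * ?T (?p A) (?q B))"
    using assms by (intro negami_union)
  also have "\<dots> = (\<Sum>A\<in>Pow (edges K). \<Sum>B\<in>Pow (edges H). \<Sum>R\<in>?I. \<Sum>S\<in>?I.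
      ?k A * ?h B * (?T (?p A) R * b R S * ?T S (?q B)))"
    by (simp add: expand[OF p q] sum_distrib_left)
  also have "\<dots> = (\<Sum>A\<in>Pow (edges K). \<Sum>R\<in>?I. \<Sum>S\<in>?I. \<Sum>B\<in>Pow (edges H).
      ?k A * ?h B * (?T (?p A) R * b R S * ?T S (?q B)))"
    \<comment> \<open>Fixing the outer index set directs the rewriting: this sum moves inward past
      those over partitions.\<close>
    by (simp add: sum.swap[of _ _ "Pow (edges H)"])
  also have "\<dots> = (\<Sum>R\<in>?I. \<Sum>S\<in>?I. \<Sum>A\<in>Pow (edges K). \<Sum>B\<in>Pow (edges H).
      ?k A * ?h B * (?T (?p A) R * b R S * ?T S (?q B)))"
    by (simp add: sum.swap[of _ _ "Pow (edges K)"])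
  \<comment> \<open>For fixed \<open>R\<close> and \<open>S\<close> the summand is a factor in
    \<open>A\<close> times a factor in \<open>B\<close>, so the double sum becomes a product, whose
    factors are the two quotient polynomials.\<close>
  also have "\<dots> = (\<Sum>R\<in>?I. \<Sum>S\<in>?I. b R S * (\<Sum>A\<in>Pow (edges K). ?k A * ?T (?p A) R) *
      (\<Sum>B\<in>Pow (edges H). ?h B * ?T (?q B) S))"
    by (intro sum.cong refl)
      (simp add: sum_distrib_left sum_distrib_right T[of _ "?q _"] mult_ac)
  also have "\<dots> = (\<Sum>P\<in>?I. \<Sum>Q\<in>?I.
      b P Q * negami (quotient_graph K P) t x y * negami (quotient_graph H Q) t x y)"
    using assms(2,3) UK UH by (intro sum.cong refl) (simp add: negami_quotient_graph)
  finally show ?thesis .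
qed

end
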